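(* Let $k\ge1$ and consider the Markov chain on states $\{0,1,\dots,k\}$ in which state $0$ is absorbing and from each state $\ell\in\{1,\dots,k\}$ the chain moves to $\ell-1$ with probability $\frac{\ell}{k}$ and to $\ell+1$ with probability $\frac{k-\ell}{k}$. Let $h(\ell)=\mathbb{E}[N\mid X_0=\ell]$ with $N=\min\{\tau\ge0:X_\tau=0\}$. Then $h(\ell)=\Theta(2^k)$ for every $\ell\in\{1,\dots,k\}$, i.e. there are absolute constants $c,C>0$ with $c\,2^k\le h(\ell)\le C\,2^k$ for all $k$ and all $1\le\ell\le k$.
   Context: $(X_\tau)$ is the Markov chain described; this chain models the Hamming distance between the Harmonic Algorithm and the adversary when all metric spaces have $2$ points. *)

theory Defs
  imports "HOL-Probability.Probability"
begin

(* bernoulli_pmf clamps its parameter to [0, 1], so from the states l > k, which lie outside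
   {0..k} and are never reached from {0..k}, the chain goes down with probability 1. *)
definition chain_step :: "nat \<Rightarrow> nat \<Rightarrow> nat pmf" where
  "chain_step k l = (if l = 0 then return_pmf 0
     else map_pmf (\<lambda>down. if down then l - 1 else l + 1) (bernoulli_pmf (real l / real k)))"

lemma pmf_chain_step_0: "pmf (chain_step k 0) 0 = 1"
  by (simp add: chain_step_def)

lemma pmf_chain_step_down:
  assumes "1 \<le> l" "l \<le> k" shows "pmf (chain_step k l) (l - 1) = real l / real k"
proof -
  have "(\<lambda>down. if down then l - 1 else l + 1) -` {l - 1} = {True}" by (auto split: if_splits)
  then show ?thesis
    using assms by (simp add: chain_step_def pmf_map measure_pmf_single)
qed

lemma pmf_chain_step_up:
  assumes "1 \<le> l" "l \<le> k" shows "pmf (chain_step k l) (l + 1) = (real k - real l) / real k"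
proof -
  have "(\<lambda>down. if down then l - 1 else l + 1) -` {l + 1} = {False}" by auto
  then show ?thesis
    using assms by (simp add: chain_step_def pmf_map measure_pmf_single field_simps)
qed

lemma set_pmf_chain_step: "l \<le> k \<Longrightarrow> set_pmf (chain_step k l) \<subseteq> {0..k}"
  by (cases "l = k") (auto simp: chain_step_def set_pmf_iff split: if_splits)

(* The law of X_n given the history (X_0, ..., X_(n-1)). *)
definition chain_kernel :: "nat \<Rightarrow> nat \<Rightarrow> nat \<Rightarrow> (nat \<Rightarrow> nat) \<Rightarrow> nat measure" where
  "chain_kernel k l n \<omega> = measure_pmf (if n = 0 then return_pmf l else chain_step k (\<omega> (n - 1)))"

global_interpretation chain: Ionescu_Tulcea "chain_kernel k l" "\<lambda>_. count_space UNIV" for k l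
proof (rule Ionescu_Tulcea.intro)
  fix n
  show "chain_kernel k l n \<in> measurable (PiM {0..<n} (\<lambda>_. count_space UNIV))
      (subprob_algebra (count_space UNIV))"
  proof (cases n)
    case (Suc m)
    have "(\<lambda>\<omega>. \<omega> m) \<in> measurable (PiM {0..<n} (\<lambda>_. count_space UNIV)) (count_space (UNIV :: nat set))"
      by (rule measurable_component_singleton) (simp add: Suc)
    moreover have "(\<lambda>x. measure_pmf (chain_step k x))
        \<in> measurable (count_space UNIV) (subprob_algebra (count_space UNIV))"
      by (simp add: space_subprob_algebra measure_pmf.subprob_space_axioms)
    ultimately have "(\<lambda>\<omega>. measure_pmf (chain_step k (\<omega> m))) \<in> measurable
        (PiM {0..<n} (\<lambda>_. count_space UNIV)) (subprob_algebra (count_space UNIV))"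
      by (rule measurable_compose)
    then show ?thesis
      by (simp add: chain_kernel_def[abs_def] Suc)
  qed (simp add: chain_kernel_def[abs_def] space_subprob_algebra measure_pmf.subprob_space_axioms)
next
  fix n and \<omega> :: "nat \<Rightarrow> nat"
  show "prob_space (chain_kernel k l n \<omega>)"
    by (simp add: chain_kernel_def measure_pmf.prob_space_axioms)
qed

(* The law, on trajectories nat => nat, of the chain started in X_0 = l. *)
definition chain_law :: "nat \<Rightarrow> nat \<Rightarrow> (nat \<Rightarrow> nat) measure" where
  "chain_law k l = chain.PF.lim k l"

definition hitting_time :: "(nat \<Rightarrow> nat) \<Rightarrow> ennreal" where
  "hitting_time \<omega> = (if \<exists>\<tau>. \<omega> \<tau> = 0 then of_nat (LEAST \<tau>. \<omega> \<tau> = 0) else \<infinity>)"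

definition expected_hitting_time :: "nat \<Rightarrow> nat \<Rightarrow> ennreal" where
  "expected_hitting_time k l = (\<integral>\<^sup>+\<omega>. hitting_time \<omega> \<partial>chain_law k l)"

lemma sets_chain_law: "sets (chain_law k l) = sets (PiM UNIV (\<lambda>_. count_space UNIV))"
  by (simp add: chain_law_def)

lemma space_chain_law: "space (chain_law k l) = UNIV"
  by (simp add: chain_law_def space_PiM)

lemma prob_space_chain_law: "prob_space (chain_law k l)"
proof
  have "emeasure (chain.PF.lim k l) (chain.PF.emb UNIV {} (space (PiM {} (\<lambda>_. count_space UNIV))))
      = emeasure (chain.CI k l {}) (space (PiM {} (\<lambda>_. count_space UNIV)))"
    by (rule chain.lim) auto
  also have "\<dots> = 1"
    using prob_space.emeasure_space_1[OF chain.PF.prob_space_P[of "{}" k l]]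
    by (simp add: chain.CI_def)
  finally show "emeasure (chain_law k l) (space (chain_law k l)) = 1"
    by (simp add: chain_law_def space_PiM prod_emb_def vimage_def restrict_def)
qed

lemma hitting_time_eq_INF: "hitting_time \<omega> = (INF \<tau>. if \<omega> \<tau> = 0 then of_nat \<tau> else \<infinity>)"
proof (cases "\<exists>\<tau>. \<omega> \<tau> = 0")
  case True
  define m where "m = (LEAST \<tau>. \<omega> \<tau> = 0)"
  have "\<omega> m = 0"
    using True unfolding m_def by (rule LeastI_ex)
  moreover have "m \<le> \<tau>" if "\<omega> \<tau> = 0" for \<tau>
    using that unfolding m_def by (rule Least_le)
  ultimately have "(INF \<tau>. if \<omega> \<tau> = 0 then of_nat \<tau> else \<infinity> :: ennreal) = of_nat m"
    by (intro antisym INF_greatest INF_lower2[of m]) auto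
  with True show ?thesis
    by (simp add: hitting_time_def m_def)
next
  case False
  then have "(\<lambda>\<tau>. if \<omega> \<tau> = 0 then of_nat \<tau> else \<infinity> :: ennreal) = (\<lambda>_. \<infinity>)"
    by auto
  with False show ?thesis
    by (simp only: hitting_time_def) simp
qed

lemma measurable_hitting_time: "hitting_time \<in> borel_measurable (chain_law k l)"
proof -
  have [measurable]: "(\<lambda>\<omega>. \<omega> \<tau>) \<in> measurable (PiM UNIV (\<lambda>_. count_space UNIV)) (count_space (UNIV :: nat set))"
    for \<tau> :: nat
    by (rule measurable_component_singleton) simp
  have "(\<lambda>\<omega>. INF \<tau>. if \<omega> \<tau> = 0 then of_nat \<tau> else \<infinity> :: ennreal)
      \<in> borel_measurable (PiM UNIV (\<lambda>_. count_space (UNIV :: nat set)))"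
    by measurable
  then show ?thesis
    by (simp only: measurable_cong_sets[OF sets_chain_law refl] hitting_time_eq_INF[symmetric])
qed

lemma chain_law_cylinder:
  "emeasure (chain_law k l) {\<omega>. \<forall>i\<le>n. \<omega> i = s i} =
     ennreal (of_bool (s 0 = l) * (\<Prod>i<n. pmf (chain_step k (s i)) (s (Suc i))))"
proof -
  let ?M = "\<lambda>_. count_space (UNIV :: nat set)"
  let ?A = "\<lambda>n. PiE {0..<n} (\<lambda>i. {s i})"
  have A[measurable]: "?A n \<in> sets (PiM {0..<n} ?M)" for n
    by (rule sets_PiM_I_finite) auto
  have C: "emeasure (chain.C k l 0 (Suc n) (\<lambda>_. undefined)) (?A (Suc n)) =
     ennreal (of_bool (s 0 = l) * (\<Prod>i<n. pmf (chain_step k (s i)) (s (Suc i))))" for n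
  proof -
    have e: "emeasure (chain.eP k l n \<omega>) (?A (Suc n)) =
        indicator (?A n) \<omega> * ennreal (if n = 0 then of_bool (s 0 = l)
          else pmf (chain_step k (s (n - 1))) (s n))"
      if \<omega>: "\<omega> \<in> space (PiM {0..<n} ?M)" for n \<omega>
    proof -
      have extn: "\<omega> \<in> extensional {0..<n}"
        using \<omega> by (simp add: space_PiM PiE_def)
      have "fun_upd \<omega> n x \<in> ?A (Suc n) \<longleftrightarrow> \<omega> \<in> ?A n \<and> x = s n" for x
      proof -
        have "fun_upd \<omega> n x \<in> extensional {0..<Suc n}"
          using extn by (auto simp: extensional_def)
        then have "fun_upd \<omega> n x \<in> ?A (Suc n) \<longleftrightarrow> (\<forall>i<Suc n. (fun_upd \<omega> n x) i = s i)"
          by (auto simp add: PiE_iff)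
        also have "\<dots> \<longleftrightarrow> (\<forall>i<n. \<omega> i = s i) \<and> x = s n"
          by (auto simp: less_Suc_eq)
        also have "(\<forall>i<n. \<omega> i = s i) \<longleftrightarrow> \<omega> \<in> ?A n"
          using extn by (auto simp add: PiE_iff)
        finally show ?thesis .
      qed
      then have "(\<lambda>x. fun_upd \<omega> n x) -` ?A (Suc n) = (if \<omega> \<in> ?A n then {s n} else {})"
        by auto
      then have "emeasure (chain.eP k l n \<omega>) (?A (Suc n)) =
          emeasure (chain_kernel k l n \<omega>) (if \<omega> \<in> ?A n then {s n} else {})"
        using \<omega> by (simp add: chain.emeasure_eP)
      then show ?thesis
        by (auto simp: chain_kernel_def emeasure_pmf_single indicator_def PiE_iff)
    qed
    have ind: "emeasure (chain.C k l 0 (Suc n) (\<lambda>_. undefined)) (?A (Suc n)) =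
        emeasure (chain.C k l 0 n (\<lambda>_. undefined)) (?A n) *
          ennreal (if n = 0 then of_bool (s 0 = l) else pmf (chain_step k (s (n - 1))) (s n))" for n
    proof -
      have u: "(\<lambda>_. undefined) \<in> space (PiM {0..<0} ?M)" by (simp add: space_PiM PiE_iff extensional_def)
      note sp = chain.space_C[OF u, of k l n, unfolded add_0]
      note st = chain.sets_C[OF u, of k l n, unfolded add_0]
      have "emeasure (chain.C k l 0 (Suc n) (\<lambda>_. undefined)) (?A (Suc n)) =
          (\<integral>\<^sup>+\<omega>. emeasure (chain.eP k l n \<omega>) (?A (Suc n)) \<partial>chain.C k l 0 n (\<lambda>_. undefined))"
        using chain.measurable_eP[of k l n] A[of "Suc n"]
        by (simp add: emeasure_bind[where N="PiM {0..<Suc n} ?M"] sp st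
            measurable_cong_sets[OF st refl])
      also have "\<dots> = (\<integral>\<^sup>+\<omega>. indicator (?A n) \<omega> * ennreal (if n = 0 then of_bool (s 0 = l)
          else pmf (chain_step k (s (n - 1))) (s n)) \<partial>chain.C k l 0 n (\<lambda>_. undefined))"
        by (intro nn_integral_cong e) (simp add: sp)
      also have "\<dots> = emeasure (chain.C k l 0 n (\<lambda>_. undefined)) (?A n) *
          ennreal (if n = 0 then of_bool (s 0 = l) else pmf (chain_step k (s (n - 1))) (s n))"
        using A[of n] by (subst nn_integral_multc) (auto simp add: st intro!: borel_measurable_indicator)
      finally show ?thesis .
    qed
    show ?thesis
    proof (induction n)
      case 0
      show ?case by (subst ind) (simp add: emeasure_return[OF A[of 0, simplified]])
    next
      case (Suc n)
      show ?case
        by (subst ind, subst Suc.IH) (simp add: ennreal_mult prod_nonneg)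
    qed
  qed
  have "{\<omega>. \<forall>i\<le>n. \<omega> i = s i} = chain.PF.emb UNIV {0..<Suc n} (?A (Suc n))"
    by (auto simp: prod_emb_def PiE_iff space_PiM less_Suc_eq_le)
  then have "emeasure (chain_law k l) {\<omega>. \<forall>i\<le>n. \<omega> i = s i} = emeasure (chain.CI k l {0..<Suc n}) (?A (Suc n))"
    using chain.lim[of "{0..<Suc n}" "?A (Suc n)" k l] A[of "Suc n"] by (simp add: chain_law_def)
  also have "\<dots> = emeasure (chain.C k l 0 (Suc n) (\<lambda>_. undefined)) (chain.PF.emb {0..<Suc n} {0..<Suc n} (?A (Suc n)))"
    by (rule chain.emeasure_CI) (auto simp: A)
  also have "chain.PF.emb {0..<Suc n} {0..<Suc n} (?A (Suc n)) = ?A (Suc n)"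
    by (rule prod_emb_id) auto
  finally show ?thesis
    by (simp only: C)
qed

end

(* For g with g 0 = 0 solving the first-step equations g y = 1 + y/k g(y-1) + (k-y)/k g(y+1), the
   expectation of g(X_n) on {N > n} drops by P(N > n) in every step.  As it is nonnegative and at
   most a constant times P(N > n), summation over n gives g l = sum P(N > n) = h(l).  The increments
   d_j = g j - g(j-1) satisfy j d_j = k + (k-j) d_(j+1), and multiplication by the binomial
   coefficient (k-1 choose j-1) makes this recursion telescope:
   d_j (k-1 choose j-1) = sum_(i >= j) (k choose i).
   Then h(l) >= d_1 = 2^k - 1, and h(l) <= h(k) is at most 2^k times the sum of the reciprocals of
   the binomial coefficients in row k-1, which is at most 3. *)
theory Submission
  imports Defs
begin

section \<open>Distribution of the chain on paths confined to a finite set\<close>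

lemma measurable_chain_component [measurable]:
  "(\<lambda>\<omega>. \<omega> i) \<in> measurable (chain_law k l) (count_space UNIV)"
  using measurable_cong_sets[OF sets_chain_law refl] measurable_component_singleton[of i UNIV]
  by blast

lemma sets_chain_law_Collect:
  assumes "Measurable.pred (chain_law k l) P"
  shows "{\<omega>. P \<omega>} \<in> sets (chain_law k l)"
  using assms unfolding pred_def by (simp add: space_chain_law)

text \<open>The end point is recorded so that the Markov property yields a recursion in
  \<open>n\<close>. \<open>A\<close> will be \<open>{0..k}\<close> to show that the chain stays in
  range, and \<open>{1..k}\<close> to describe survival.\<close>

definition confined :: "nat set \<Rightarrow> nat \<Rightarrow> nat \<Rightarrow> (nat \<Rightarrow> nat) set" where
  "confined A n x = {\<omega>. (\<forall>i\<le>n. \<omega> i \<in> A) \<and> \<omega> n = x}"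

lemma sets_confined [measurable]: "confined A n x \<in> sets (chain_law k l)"
  unfolding confined_def by (rule sets_chain_law_Collect) measurable

lemma measure_cylinder:
  "measure (chain_law k l) {\<omega>. \<forall>i\<le>n. \<omega> i = s i} =
     of_bool (s 0 = l) * (\<Prod>i<n. pmf (chain_step k (s i)) (s (Suc i)))"
  by (simp add: measure_def chain_law_cylinder prod_nonneg)

lemma sets_cylinder [measurable]: "{\<omega>. \<forall>i\<le>n. \<omega> i = s i} \<in> sets (chain_law k l)"
  by (rule sets_chain_law_Collect) measurable

lemma measure_confined_0:
  assumes "x \<in> A"
  shows "measure (chain_law k l) (confined A 0 x) = of_bool (x = l)"
proof -
  have "confined A 0 x = {\<omega>. \<forall>i\<le>0. \<omega> i = (\<lambda>_. x) i}"
    using assms by (auto simp: confined_def)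
  then show ?thesis
    by (simp only: measure_cylinder) simp
qed

text \<open>The Markov property. As \<open>A\<close> is finite, the event splits into finitely many
  cylinders, and prolonging one of them multiplies its probability by a factor that depends only on
  its last state \<open>y\<close>.\<close>

lemma measure_confined_step:
  assumes "finite A"
  shows "measure (chain_law k l) {\<omega> \<in> confined A n y. \<omega> (Suc n) = x} =
    measure (chain_law k l) (confined A n y) * pmf (chain_step k y) x"
proof -
  interpret prob_space "chain_law k l" by (rule prob_space_chain_law)
  \<comment> \<open>Extensionality outside \<open>{..n}\<close> gives each initial path exactly one
    representative, so \<open>T\<close> is finite and its cylinders are disjoint.\<close>
  define T where "T = {s \<in> PiE {..n} (\<lambda>_. A). s n = y}"
  have "finite T"
    unfolding T_def using assms by (intro finite_subset[OF _ finite_PiE[of "{..n}" "\<lambda>_. A"]]) auto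
  let ?cyl = "\<lambda>n s. {\<omega>. \<forall>i\<le>n. \<omega> i = s i} :: (nat \<Rightarrow> nat) set"
  let ?ext = "\<lambda>s. s(Suc n := x)"
  have restr: "restrict \<omega> {..n} \<in> T" if "\<omega> \<in> confined A n y" for \<omega>
    using that by (auto simp: confined_def T_def)
  have disj: "disjoint_family_on (?cyl n) T"
    by (auto simp: disjoint_family_on_def T_def intro!: PiE_ext)
  have "confined A n y = (\<Union>s\<in>T. ?cyl n s)"
  proof (intro equalityI subsetI)
    fix \<omega> assume "\<omega> \<in> confined A n y"
    from restr[OF this] show "\<omega> \<in> (\<Union>s\<in>T. ?cyl n s)"
      by (intro UN_I[of "restrict \<omega> {..n}"]) auto
  qed (auto simp: confined_def T_def PiE_iff)
  then have "prob (confined A n y) = (\<Sum>s\<in>T. prob (?cyl n s))"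
    using \<open>finite T\<close> disj by (simp add: finite_measure_finite_Union image_subset_iff sets_cylinder)
  moreover have "{\<omega> \<in> confined A n y. \<omega> (Suc n) = x} = (\<Union>s\<in>T. ?cyl (Suc n) (?ext s))"
  proof (intro equalityI subsetI)
    fix \<omega> assume "\<omega> \<in> {\<omega> \<in> confined A n y. \<omega> (Suc n) = x}"
    then show "\<omega> \<in> (\<Union>s\<in>T. ?cyl (Suc n) (?ext s))"
      by (intro UN_I[of "restrict \<omega> {..n}"] restr) auto
  qed (auto simp: confined_def T_def PiE_iff)
  moreover have "disjoint_family_on (\<lambda>s. ?cyl (Suc n) (?ext s)) T"
    unfolding disjoint_family_on_def
  proof (intro ballI impI)
    fix s t assume "s \<in> T" "t \<in> T" "s \<noteq> t"
    with disj have "?cyl n s \<inter> ?cyl n t = {}"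
      by (auto simp: disjoint_family_on_def)
    moreover have "?cyl (Suc n) (?ext u) \<subseteq> ?cyl n u" for u
    proof (intro subsetI CollectI allI impI)
      fix \<omega> i assume "\<omega> \<in> ?cyl (Suc n) (?ext u)" "i \<le> n"
      then have "\<omega> i = ?ext u i" by simp
      with \<open>i \<le> n\<close> show "\<omega> i = u i" by simp
    qed
    ultimately show "?cyl (Suc n) (?ext s) \<inter> ?cyl (Suc n) (?ext t) = {}"
      by blast
  qed
  then have "prob (\<Union>s\<in>T. ?cyl (Suc n) (?ext s)) = (\<Sum>s\<in>T. prob (?cyl (Suc n) (?ext s)))"
    using \<open>finite T\<close> by (intro finite_measure_finite_Union) (auto simp only: intro!: sets_cylinder)
  moreover have "prob (?cyl (Suc n) (?ext s)) = prob (?cyl n s) * pmf (chain_step k y) x" if "s \<in> T" for s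
    using that unfolding measure_cylinder by (simp add: T_def)
  ultimately show ?thesis
    by (simp add: sum_distrib_right)
qed

lemma measure_confined_Suc:
  assumes "finite A" "x \<in> A"
  shows "measure (chain_law k l) (confined A (Suc n) x) =
    (\<Sum>y\<in>A. measure (chain_law k l) (confined A n y) * pmf (chain_step k y) x)"
proof -
  interpret prob_space "chain_law k l" by (rule prob_space_chain_law)
  have "confined A (Suc n) x = (\<Union>y\<in>A. {\<omega> \<in> confined A n y. \<omega> (Suc n) = x})"
    using assms by (auto simp: confined_def le_Suc_eq)
  moreover have "{\<omega> \<in> confined A n y. \<omega> (Suc n) = x} \<in> events" for y
    unfolding confined_def mem_Collect_eq by (rule sets_chain_law_Collect) measurable
  then have "prob (\<Union>y\<in>A. {\<omega> \<in> confined A n y. \<omega> (Suc n) = x}) =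
      (\<Sum>y\<in>A. prob {\<omega> \<in> confined A n y. \<omega> (Suc n) = x})"
    using assms
    by (intro finite_measure_finite_Union) (auto simp: disjoint_family_on_def confined_def)
  ultimately show ?thesis
    using assms by (simp add: measure_confined_step)
qed

text \<open>The adjoint form of the recursion: one step passes from the distribution to the test
  function. Constant \<open>f\<close> gives conservation of mass, and a solution of the first-step
  equations gives the drift.\<close>

lemma sum_confined_Suc:
  fixes f :: "nat \<Rightarrow> real"
  assumes "finite A"
  shows "(\<Sum>x\<in>A. measure (chain_law k l) (confined A (Suc n) x) * f x) =
    (\<Sum>y\<in>A. measure (chain_law k l) (confined A n y) * (\<Sum>x\<in>A. pmf (chain_step k y) x * f x))"
proof -
  have "(\<Sum>x\<in>A. measure (chain_law k l) (confined A (Suc n) x) * f x) =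
      (\<Sum>x\<in>A. \<Sum>y\<in>A. measure (chain_law k l) (confined A n y) * (pmf (chain_step k y) x * f x))"
    using assms by (simp add: measure_confined_Suc sum_distrib_right mult.assoc)
  also have "\<dots> = (\<Sum>y\<in>A. \<Sum>x\<in>A. measure (chain_law k l) (confined A n y) * (pmf (chain_step k y) x * f x))"
    by (rule sum.swap)
  finally show ?thesis
    by (simp add: sum_distrib_left)
qed

lemma measure_confined_UN:
  assumes "finite A"
  shows "measure (chain_law k l) {\<omega>. \<forall>i\<le>n. \<omega> i \<in> A} =
    (\<Sum>x\<in>A. measure (chain_law k l) (confined A n x))"
proof -
  interpret prob_space "chain_law k l" by (rule prob_space_chain_law)
  have "{\<omega>. \<forall>i\<le>n. \<omega> i \<in> A} = (\<Union>x\<in>A. confined A n x)"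
    by (auto simp: confined_def)
  moreover have "prob (\<Union>x\<in>A. confined A n x) = (\<Sum>x\<in>A. prob (confined A n x))"
    using assms
    by (intro finite_measure_finite_Union) (auto simp: disjoint_family_on_def confined_def intro: sets_confined[unfolded confined_def])
  ultimately show ?thesis by simp
qed

text \<open>No step from \<open>{0..k}\<close> leaves this set, so its mass remains 1 at every time;
  countably many times leave only a null set.\<close>

lemma AE_chain_le:
  assumes "l \<le> k"
  shows "AE \<omega> in chain_law k l. \<forall>n. \<omega> n \<le> k"
proof -
  interpret prob_space "chain_law k l" by (rule prob_space_chain_law)
  have *: "(\<Sum>x\<in>{0..k}. prob (confined {0..k} n x)) = 1" for n
  proof (induction n)
    case 0
    then show ?case
      using assms by (simp add: measure_confined_0 of_bool_def del: atLeast0AtMost)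
  next
    case (Suc n)
    have "(\<Sum>x\<in>{0..k}. pmf (chain_step k y) x) = 1" if "y \<in> {0..k}" for y
      using that set_pmf_chain_step[of y k] by (intro sum_pmf_eq_1) auto
    then show ?case
      using sum_confined_Suc[of "{0..k}" k l n "\<lambda>_. 1"] Suc by simp
  qed
  have "AE \<omega> in chain_law k l. \<omega> \<in> {\<omega>. \<forall>i\<le>n. \<omega> i \<in> {0..k}}" for n
    using *[of n] by (intro AE_prob_1) (simp only: measure_confined_UN finite_atLeastAtMost)
  then have "AE \<omega> in chain_law k l. \<forall>n. \<omega> \<in> {\<omega>. \<forall>i\<le>n. \<omega> i \<in> {0..k}}"
    by (simp only: AE_all_countable) simp
  then show ?thesis
    by eventually_elim auto
qed

section \<open>The expected hitting time as a sum of survival probabilities\<close>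

text \<open>The tail-sum formula, path by path: the times at which 0 has not yet been visited are
  counted. On a path that never visits 0 every term is 1 and both sides are infinite.\<close>

lemma hitting_time_eq_suminf:
  "hitting_time \<omega> = (\<Sum>n. indicator {\<omega>. \<forall>i\<le>n. \<omega> i \<noteq> 0} \<omega>)"
proof (cases "\<exists>\<tau>. \<omega> \<tau> = 0")
  case True
  define m where "m = (LEAST \<tau>. \<omega> \<tau> = 0)"
  have "\<omega> m = 0"
    using True unfolding m_def by (rule LeastI_ex)
  moreover have "\<omega> i \<noteq> 0" if "i < m" for i
    using that not_less_Least unfolding m_def by blast
  ultimately have "(\<forall>i\<le>n. \<omega> i \<noteq> 0) \<longleftrightarrow> n < m" for n
    by (meson le_less_trans linorder_not_less)
  then have "(\<Sum>n. indicator {\<omega>. \<forall>i\<le>n. \<omega> i \<noteq> 0} \<omega> :: ennreal) = (\<Sum>n. of_bool (n < m))"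
    by (simp add: indicator_def of_bool_def)
  also have "\<dots> = (\<Sum>n<m. of_bool (n < m))"
    by (rule suminf_finite) auto
  finally show ?thesis
    using True by (simp add: hitting_time_def m_def)
next
  case False
  then have "hitting_time \<omega> = top" "(\<Sum>n. indicator {\<omega>. \<forall>i\<le>n. \<omega> i \<noteq> 0} \<omega>) = (SUP n. of_nat n :: ennreal)"
    by (simp_all add: hitting_time_def suminf_eq_SUP del: SUP_apply)
  then show ?thesis
    by (simp only: ennreal_SUP_of_nat_eq_top)
qed

text \<open>Sum and integral are exchanged by nonnegativity. Up to a null set, avoiding 0 means
  staying in the finite set \<open>{1..k}\<close>, to which the recursions apply.\<close>

lemma expected_hitting_time_eq_suminf:
  assumes "l \<le> k"
  shows "expected_hitting_time k l =
    (\<Sum>n. ennreal (\<Sum>x\<in>{1..k}. measure (chain_law k l) (confined {1..k} n x)))"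
proof -
  interpret prob_space "chain_law k l" by (rule prob_space_chain_law)
  have meas: "{\<omega>. \<forall>i\<le>n. \<omega> i \<in> A} \<in> events" for n A
    by (rule sets_chain_law_Collect) measurable
  have meas': "{\<omega>. \<forall>i\<le>n. \<omega> i \<noteq> 0} \<in> events" for n
    using meas[of n "-{0}"] by simp
  have "expected_hitting_time k l = (\<Sum>n. emeasure (chain_law k l) {\<omega>. \<forall>i\<le>n. \<omega> i \<noteq> 0})"
    using meas' by (simp add: expected_hitting_time_def hitting_time_eq_suminf nn_integral_suminf)
  also have "emeasure (chain_law k l) {\<omega>. \<forall>i\<le>n. \<omega> i \<noteq> 0} =
      emeasure (chain_law k l) {\<omega>. \<forall>i\<le>n. \<omega> i \<in> {1..k}}" for n
  proof (rule emeasure_eq_AE)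
    show "AE \<omega> in chain_law k l. \<omega> \<in> {\<omega>. \<forall>i\<le>n. \<omega> i \<noteq> 0} \<longleftrightarrow> \<omega> \<in> {\<omega>. \<forall>i\<le>n. \<omega> i \<in> {1..k}}"
      using AE_chain_le[OF assms] by eventually_elim (auto simp: Suc_le_eq)
  qed (rule meas meas')+
  then have "(\<Sum>n. emeasure (chain_law k l) {\<omega>. \<forall>i\<le>n. \<omega> i \<noteq> 0}) =
      (\<Sum>n. ennreal (\<Sum>x\<in>{1..k}. prob (confined {1..k} n x)))"
    by (simp only: emeasure_eq_measure measure_confined_UN finite_atLeastAtMost)
  finally show ?thesis .
qed

section \<open>The first-step equations determine the expected hitting time\<close>

text \<open>Since \<open>f 0 = 0\<close>, restoring the state 0 changes nothing, and the sum over
  surviving states becomes a full expectation. At \<open>y = k\<close> the value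
  \<open>f (k + 1)\<close> has weight 0.\<close>

lemma sum_chain_step:
  fixes f :: "nat \<Rightarrow> real"
  assumes "1 \<le> y" "y \<le> k" "f 0 = 0"
  shows "(\<Sum>x\<in>{1..k}. pmf (chain_step k y) x * f x) =
    y / k * f (y - 1) + (real k - real y) / k * f (y + 1)"
proof -
  have "(\<Sum>x\<in>{1..k}. pmf (chain_step k y) x * f x) = (\<Sum>x\<in>{0..k}. pmf (chain_step k y) x * f x)"
    using assms by (intro sum.mono_neutral_left) (auto simp: not_less_eq_eq)
  also have "\<dots> = measure_pmf.expectation (chain_step k y) f"
    using assms set_pmf_chain_step[of y k]
    by (subst integral_measure_pmf_real[of "{0..k}"]) (auto simp: mult.commute)
  also have "\<dots> = y / k * f (y - 1) + (real k - real y) / k * f (y + 1)"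
    using assms by (simp add: chain_step_def field_simps)
  finally show ?thesis .
qed

lemma expected_hitting_time_eq:
  fixes g :: "nat \<Rightarrow> real"
  assumes l: "1 \<le> l" "l \<le> k"
    and g0: "g 0 = 0" and nonneg: "\<And>y. 0 \<le> g y"
    and poisson: "\<And>y. 1 \<le> y \<Longrightarrow> y \<le> k \<Longrightarrow> g y = 1 + y / k * g (y - 1) + (real k - real y) / k * g (y + 1)"
  shows "expected_hitting_time k l = ennreal (g l)"
proof -
  \<comment> \<open>\<open>R n\<close> is the law of X_n restricted to survival, \<open>Q n\<close>
    is P(N > n), and \<open>V n\<close> is the expectation of g(X_n) on that event.\<close>
  define R where "R n x = measure (chain_law k l) (confined {1..k} n x)" for n x
  define Q where "Q n = (\<Sum>x\<in>{1..k}. R n x)" for n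
  define V where "V n = (\<Sum>x\<in>{1..k}. R n x * g x)" for n
  have R_nonneg: "0 \<le> R n x" for n x
    by (simp add: R_def)
  have V_Suc: "V (Suc n) = V n - Q n" for n
  proof -
    have "V (Suc n) = (\<Sum>y\<in>{1..k}. R n y * (\<Sum>x\<in>{1..k}. pmf (chain_step k y) x * g x))"
      unfolding V_def R_def by (rule sum_confined_Suc) simp
    also have "\<dots> = (\<Sum>y\<in>{1..k}. R n y * (g y - 1))"
    proof (intro sum.cong refl)
      fix y assume "y \<in> {1..k}"
      then show "R n y * (\<Sum>x\<in>{1..k}. pmf (chain_step k y) x * g x) = R n y * (g y - 1)"
        using sum_chain_step[of y k g] poisson[of y] g0 by simp
    qed
    finally show ?thesis
      by (simp add: V_def Q_def right_diff_distrib sum_subtractf)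
  qed
  have "V 0 = g l"
    using l by (simp add: V_def R_def measure_confined_0 of_bool_def if_distrib[of "\<lambda>x. x * _"] cong: if_cong)
  then have partial: "(\<Sum>n<m. Q n) = g l - V m" for m
    by (induction m) (auto simp: V_Suc)
  have Q_nonneg: "0 \<le> Q n" for n
    unfolding Q_def by (intro sum_nonneg R_nonneg)
  have V_nonneg: "0 \<le> V n" for n
    unfolding V_def by (intro sum_nonneg mult_nonneg_nonneg R_nonneg nonneg)
  \<comment> \<open>The partial sums are \<open>g l - V m \<le> g l\<close>.\<close>
  have "summable Q"
    using partial V_nonneg Q_nonneg by (intro summableI_nonneg_bounded[of Q "g l"]) auto
  then have "Q \<longlonglongrightarrow> 0"
    by (rule summable_LIMSEQ_zero)
  then have lim: "(\<lambda>n. Q n * (\<Sum>x\<in>{1..k}. g x)) \<longlonglongrightarrow> 0"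
    by (rule tendsto_mult_left_zero)
  \<comment> \<open>Only finitely many states occur, so \<open>g\<close> is bounded on them by its
    sum. This forces the remainder \<open>V m\<close> to vanish in the limit.\<close>
  have "V n \<le> Q n * (\<Sum>x\<in>{1..k}. g x)" for n
    unfolding V_def Q_def sum_distrib_right
    by (intro sum_mono mult_left_mono R_nonneg member_le_sum nonneg) auto
  then have "V \<longlonglongrightarrow> 0"
    using V_nonneg by (intro tendsto_sandwich[OF _ _ tendsto_const lim]) auto
  then have "(\<lambda>m. \<Sum>n<m. Q n) \<longlonglongrightarrow> g l - 0"
    unfolding partial by (intro tendsto_intros)
  then have "Q sums g l"
    by (simp add: sums_def)
  then have "(\<Sum>n. ennreal (Q n)) = ennreal (g l)"
    using Q_nonneg by (simp add: suminf_ennreal2 sums_iff)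
  then show ?thesis
    using l by (simp add: expected_hitting_time_eq_suminf Q_def R_def)
qed

section \<open>Descent times and binomial coefficients\<close>

(* The expected time to get from j to j - 1.  At j = k + 1 both numerator and denominator vanish and
   the value is 0, so descent_time_rec also holds at the boundary y = k. *)
definition descent_time :: "nat \<Rightarrow> nat \<Rightarrow> real" where
  "descent_time k j = (\<Sum>i\<in>{j..k}. real (k choose i)) / real ((k - 1) choose (j - 1))"

lemma descent_time_nonneg: "0 \<le> descent_time k j"
  by (simp add: descent_time_def sum_nonneg)

lemma descent_time_rec:
  assumes "1 \<le> y" "y \<le> k"
  shows "y * descent_time k y = k + (real k - real y) * descent_time k (y + 1)"
proof -
  define S where "S j = (\<Sum>i\<in>{j..k}. real (k choose i))" for j
  obtain m i where k: "k = Suc m" and y: "y = Suc i" and im: "i \<le> m"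
    using assms by (cases k; cases y) auto
  define c where "c = real (m choose i)"
  have c: "c > 0"
    using im by (simp add: c_def)
  have S: "S y = real (k choose y) + S (y + 1)"
    using assms unfolding S_def by (simp add: sum.atLeast_Suc_atMost)
  \<comment> \<open>Absorption: the first term of the tail sum supplies the summand \<open>k\<close>
    of the recursion.\<close>
  have "y * real (k choose y) = k * c"
    unfolding k y c_def of_nat_mult[symmetric] by (simp only: Suc_times_binomial mult.commute)
  \<comment> \<open>The identity \<open>y * (m choose y) = (k - y) * (m choose i)\<close> exchanges
    the two denominators. For \<open>i = m\<close>, that is \<open>y = k\<close>, both sides are 0
    because \<open>S (k + 1)\<close> is an empty sum.\<close>
  moreover have "(real k - real y) * (S (y + 1) / real (m choose y)) = y * S (y + 1) / c"
  proof (cases "i = m")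
    case True
    then show ?thesis by (simp add: S_def k y)
  next
    case False
    with im have pos: "real (m choose y) > 0" by (simp add: y)
    have "Suc i * (m choose Suc i) = (m - i) * (m choose i)"
      using im binomial_absorb_comp[of m i] binomial_absorption[of i m] by simp
    then have "real y * real (m choose y) = real (m - i) * c"
      unfolding y c_def by (metis of_nat_mult)
    then have "real y * real (m choose y) = (real k - real y) * c"
      using im by (simp add: k y of_nat_diff)
    then show ?thesis
      using pos c by (simp add: divide_eq_eq eq_divide_eq)
  qed
  moreover have "descent_time k y = S y / c" "descent_time k (y + 1) = S (y + 1) / real (m choose y)"
    by (simp_all add: descent_time_def S_def c_def k y)
  moreover have "y * (S y / c) = y * real (k choose y) / c + y * S (y + 1) / c"
    by (simp only: S distrib_left add_divide_distrib times_divide_eq_right)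
  ultimately show ?thesis
    using c by simp
qed

text \<open>For positive \<open>n\<close> the two outer terms are 1 each, and the
  \<open>n - 1\<close> inner ones are at most \<open>1 / n\<close> each.\<close>

lemma sum_inverse_binomial_le: "(\<Sum>i\<le>n. 1 / real (n choose i)) \<le> 3"
proof (cases n)
  case (Suc m)
  have "1 / real (n choose i) \<le> 1 / real n" if "i \<in> {1..m}" for i
  proof -
    have "n \<le> n choose i"
      using that Suc by (intro upper_le_binomial) auto
    then show ?thesis
      using Suc that by (intro divide_left_mono) auto
  qed
  then have "(\<Sum>i\<in>{1..m}. 1 / real (n choose i)) \<le> (\<Sum>i\<in>{1..m}. 1 / real n)"
    by (rule sum_mono)
  also have "\<dots> \<le> 1"
    using Suc by simp
  finally have "(\<Sum>i\<in>{1..m}. 1 / real (n choose i)) \<le> 1" .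
  moreover have "{..n} = insert 0 (insert n {1..m})"
    using Suc by auto
  ultimately show ?thesis
    using Suc by simp
qed simp

lemma expected_hitting_time_eq_sum:
  assumes "1 \<le> l" "l \<le> k"
  shows "expected_hitting_time k l = ennreal (\<Sum>j\<in>{1..l}. descent_time k j)"
proof (rule expected_hitting_time_eq)
  fix y assume y: "1 \<le> y" "y \<le> k"
  obtain i where i: "y = Suc i"
    using y by (cases y) auto
  define g where "g = (\<Sum>j\<in>{1..i}. descent_time k j)"
  have "y * descent_time k y = k + (real k - real y) * descent_time k (y + 1)"
    using y by (rule descent_time_rec)
  \<comment> \<open>After multiplication by \<open>k\<close> the terms in \<open>g\<close> cancel,
    and the recursion for the descent times is left.\<close>
  then have "g + descent_time k y =
      1 + y / k * g + (real k - real y) / k * (g + descent_time k y + descent_time k (y + 1))"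
    using y by (simp add: field_simps)
  moreover have "(\<Sum>j\<in>{1..y - 1}. descent_time k j) = g"
      "(\<Sum>j\<in>{1..y}. descent_time k j) = g + descent_time k y"
      "(\<Sum>j\<in>{1..y + 1}. descent_time k j) = g + descent_time k y + descent_time k (y + 1)"
    by (simp_all add: i g_def)
  ultimately show "(\<Sum>j\<in>{1..y}. descent_time k j) = 1 + y / k * (\<Sum>j\<in>{1..y - 1}. descent_time k j) +
      (real k - real y) / k * (\<Sum>j\<in>{1..y + 1}. descent_time k j)"
    by (simp only:)
qed (use assms in \<open>simp_all add: sum_nonneg descent_time_nonneg\<close>)

section \<open>Bounds of order 2^k\<close>

lemma descent_time_1_ge:
  assumes "1 \<le> k"
  shows "1 / 2 * 2 ^ k \<le> descent_time k 1"
proof -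
  have "real (\<Sum>i\<le>k. k choose i) = real (2 ^ k)"
    by (simp only: choose_row_sum)
  moreover have "{..k} = insert 0 {1..k}"
    by auto
  ultimately have "descent_time k 1 = 2 ^ k - 1"
    by (simp add: descent_time_def)
  \<comment> \<open>Hence \<open>1 \<le> 2 ^ k / 2\<close>, and \<open>2 ^ k - 1\<close> is at least
    half of \<open>2 ^ k\<close>.\<close>
  moreover have "(2 :: real) ^ 1 \<le> 2 ^ k"
    using assms by (intro power_increasing) auto
  ultimately show ?thesis by simp
qed

lemma sum_descent_time_le:
  assumes "1 \<le> k"
  shows "(\<Sum>j\<in>{1..k}. descent_time k j) \<le> 3 * 2 ^ k"
proof -
  \<comment> \<open>Every numerator is bounded by the whole binomial row, which leaves the
    reciprocals of row \<open>k - 1\<close> to be summed.\<close>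
  have "(\<Sum>i\<in>{j..k}. real (k choose i)) \<le> 2 ^ k" for j
  proof -
    have "(\<Sum>i\<in>{j..k}. real (k choose i)) \<le> (\<Sum>i\<le>k. real (k choose i))"
      by (rule sum_mono2) auto
    also have "\<dots> = real (2 ^ k)"
      by (simp only: choose_row_sum flip: of_nat_sum)
    finally show ?thesis by simp
  qed
  then have "(\<Sum>j\<in>{1..k}. descent_time k j) \<le> (\<Sum>j\<in>{1..k}. 2 ^ k * (1 / real ((k - 1) choose (j - 1))))"
    unfolding descent_time_def by (intro sum_mono) (simp add: divide_right_mono)
  also have "\<dots> = 2 ^ k * (\<Sum>j\<in>{1..k}. 1 / real ((k - 1) choose (j - 1)))"
    by (simp only: sum_distrib_left)
  also have "(\<Sum>j\<in>{1..k}. 1 / real ((k - 1) choose (j - 1))) = (\<Sum>i\<le>k - 1. 1 / real ((k - 1) choose i))"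
    using assms by (intro sum.reindex_bij_witness[of _ Suc "\<lambda>j. j - 1"]) auto
  also have "2 ^ k * \<dots> \<le> 2 ^ k * 3"
    by (intro mult_left_mono sum_inverse_binomial_le) simp
  finally show ?thesis by simp
qed

theorem theorem6:
  shows "\<exists>c C :: real. 0 < c \<and> 0 < C \<and>
    (\<forall>k::nat. 1 \<le> k \<longrightarrow> (\<forall>l\<in>{1..k}.
      ennreal (c * 2 ^ k) \<le> expected_hitting_time k l \<and>
      expected_hitting_time k l \<le> ennreal (C * 2 ^ k)))"
proof (rule exI[of _ "1 / 2"], rule exI[of _ 3], intro conjI allI impI ballI)
  fix k l :: nat assume k: "1 \<le> k" and l: "l \<in> {1..k}"
  have E: "expected_hitting_time k l = ennreal (\<Sum>j\<in>{1..l}. descent_time k j)"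
    using l by (intro expected_hitting_time_eq_sum) auto
  \<comment> \<open>As the descent times are nonnegative, the sum up to \<open>l\<close> lies
    between its first term and the sum up to \<open>k\<close>, so both bounds are uniform in
    \<open>l\<close>.\<close>
  have "descent_time k 1 \<le> (\<Sum>j\<in>{1..l}. descent_time k j)"
    using l by (intro member_le_sum descent_time_nonneg) auto
  with descent_time_1_ge[OF k] show "ennreal (1 / 2 * 2 ^ k) \<le> expected_hitting_time k l"
    unfolding E by (intro ennreal_leI) linarith
  have "(\<Sum>j\<in>{1..l}. descent_time k j) \<le> (\<Sum>j\<in>{1..k}. descent_time k j)"
    using l by (intro sum_mono2 descent_time_nonneg) auto
  with sum_descent_time_le[OF k] show "expected_hitting_time k l \<le> ennreal (3 * 2 ^ k)"
    unfolding E by (intro ennreal_leI) linarith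
qed auto

end
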